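(* Let $G$ be a (simple, finite) graph with vertex set $V(G)=\{1,\ldots,n\}$, $n\ge 4$. Let $e=\{i,j\}$ and $f=\{k,\ell\}$ be edges of $G$ with no common vertex, such that $G\setminus\{e\}$ and $G\setminus\{f\}$ are connected. Let $L$, $L_e$, $L_f$ be the Laplacian matrices of $G$, $G\setminus\{e\}$, $G\setminus\{f\}$ respectively, and let $x_e, x_f$ be the incidence vectors of $e,f$ (with respect to fixed orientations of these edges). Then the following statements are equivalent: (i) $r_G(i,j)=r_{G\setminus\{f\}}(i,j)$; (ii) $r_G(k,\ell)=r_{G\setminus\{e\}}(k,\ell)$; (iii) $\tau(G\setminus\{e\})\,\tau(G\setminus\{f\})=\tau(G)\,\tau(G\setminus\{e,f\})$; (iv) the $i$-th and $j$-th coordinates of $L^+x_f$ are equal; (v) the $i$-th and $j$-th coordinates of $L^-x_f$ are equal for any generalized inverse $L^-$ of $L$; (vi) the $i$-th and $j$-th coordinates of $L_f^+x_f$ are equal; (vii) the $i$-th and $j$-th coordinates of $L_f^-x_f$ are equal for any generalized inverse $L_f^-$ of $L_f$; (viii) the $k$-th and $\ell$-th coordinates of $L^+x_e$ are equal; (ix) the $k$-th and $\ell$-th coordinates of $L^-x_e$ are equal for any generalized inverse $L^-$ of $L$; (x) the $k$-th and $\ell$-th coordinates of $L_e^+x_e$ are equal; (xi) the $k$-th and $\ell$-th coordinates of $L_e^-x_e$ are equal for any generalized inverse $L_e^-$ of $L_e$.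
   Context: For a graph $H$ on vertices $\{1,\dots,n\}$ the Laplacian is $L=D-A$, where $A$ is the adjacency matrix and $D$ the diagonal matrix of vertex degrees. A generalized inverse of a matrix $M$ is any matrix $M^-$ with $MM^-M=M$; $M^+$ denotes the Moore–Penrose inverse. $\tau(H)$ denotes the number of spanning trees of $H$. For a connected graph $H$ with Laplacian $L$ and vertices $a,b$, the resistance distance is $r_H(a,b)=h_{aa}+h_{bb}-h_{ab}-h_{ba}$ where $H=(h_{st})$ is any generalized inverse of $L$ (this is independent of the choice; e.g. $r_H(a,b)=\ell^+_{aa}+\ell^+_{bb}-2\ell^+_{ab}$). If an edge $\{a,b\}$ is oriented from $a$ to $b$, its incidence vector is the $n\times 1$ vector with $1$ in position $a$, $-1$ in position $b$, and $0$ elsewhere. *)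

theory Defs
  imports "HOL-Analysis.Analysis"
begin

text \<open>
  A simple graph has vertex set \<^term>\<open>UNIV :: 'n::finite set\<close> and is represented by its set of
  edges, each a two-element vertex set.  Deleting edges is set difference.
\<close>

definition simple_graph :: "'n set set \<Rightarrow> bool" where
  "simple_graph E \<longleftrightarrow> (\<forall>e\<in>E. card e = 2)"

definition connected_graph :: "'n set set \<Rightarrow> bool" where
  "connected_graph E \<longleftrightarrow> (\<forall>u v. (\<lambda>a b. {a, b} \<in> E)\<^sup>*\<^sup>* u v)"

definition graph_cycle :: "'n set set \<Rightarrow> 'n list \<Rightarrow> bool" where
  "graph_cycle E vs \<longleftrightarrow> 3 \<le> length vs \<and> distinct vs \<and>
     (\<forall>m < length vs. {vs ! m, vs ! (Suc m mod length vs)} \<in> E)"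

definition spanning_trees :: "'n set set \<Rightarrow> 'n set set set" where
  "spanning_trees E = {T. T \<subseteq> E \<and> connected_graph T \<and> (\<nexists>vs. graph_cycle T vs)}"

definition num_spanning_trees :: "'n::finite set set \<Rightarrow> nat" ("\<tau>") where
  "\<tau> E = card (spanning_trees E)"

definition degree :: "'n::finite set set \<Rightarrow> 'n \<Rightarrow> nat" where
  "degree E v = card {u. {v, u} \<in> E}"

definition adjacency_matrix :: "'n::finite set set \<Rightarrow> real^'n^'n" where
  "adjacency_matrix E = (\<chi> u v. if {u, v} \<in> E then 1 else 0)"

definition degree_matrix :: "'n::finite set set \<Rightarrow> real^'n^'n" where
  "degree_matrix E = (\<chi> u v. if u = v then real (degree E u) else 0)"

definition laplacian :: "'n::finite set set \<Rightarrow> real^'n^'n" where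
  "laplacian E = degree_matrix E - adjacency_matrix E"

definition incidence_vector :: "'n \<Rightarrow> 'n \<Rightarrow> real^'n::finite" where
  "incidence_vector a b = (\<chi> v. if v = a then 1 else if v = b then - 1 else 0)"

definition generalized_inverse :: "real^'m^'n \<Rightarrow> real^'n^'m \<Rightarrow> bool" where
  "generalized_inverse M X \<longleftrightarrow> M ** X ** M = M"

definition is_moore_penrose :: "real^'m^'n \<Rightarrow> real^'n^'m \<Rightarrow> bool" where
  "is_moore_penrose M X \<longleftrightarrow> M ** X ** M = M \<and> X ** M ** X = X \<and>
     transpose (M ** X) = M ** X \<and> transpose (X ** M) = X ** M"

definition moore_penrose :: "real^'m^'n \<Rightarrow> real^'n^'m" where
  "moore_penrose M = (THE X. is_moore_penrose M X)"

text \<open>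
  The resistance distance is computed from an arbitrarily chosen generalized inverse of the
  Laplacian; for a connected graph, the lemma \<open>resistance_distance_eq\<close> below shows that the choice
  is immaterial.
\<close>

definition resistance_distance :: "'n::finite set set \<Rightarrow> 'n \<Rightarrow> 'n \<Rightarrow> real" where
  "resistance_distance E a b =
     (let H = (SOME H. generalized_inverse (laplacian E) H)
      in H $ a $ a + H $ b $ b - H $ a $ b - H $ b $ a)"

definition all_equivalent :: "bool list \<Rightarrow> bool" where
  "all_equivalent Ps \<longleftrightarrow> (\<forall>P \<in> set Ps. \<forall>Q \<in> set Ps. P \<longleftrightarrow> Q)"

lemma generalized_inverse_exists:
  fixes M :: "real^'m^'n"
  shows "\<exists>X. generalized_inverse M X"
proof -
  obtain g where g: "linear g" "\<And>v. v \<in> range ((*v) M) \<Longrightarrow> M *v (g v) = v"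
    using linear_exists_right_inverse_on[OF matrix_vector_mul_linear subspace_UNIV, of M] by auto
  have "M ** matrix g ** M = M"
    unfolding matrix_eq by (simp add: g matrix_works flip: matrix_vector_mul_assoc)
  thus ?thesis by (auto simp: generalized_inverse_def)
qed

lemma gram_cancel:
  fixes M :: "real^'m^'n"
  assumes "transpose M ** M ** Y = transpose M ** M ** Z"
  shows "M ** Y = M ** Z"
  unfolding matrix_eq
proof
  fix x
  define y where "y = Y *v x - Z *v x"
  have "transpose M *v (M *v y) = 0"
    using assms unfolding y_def matrix_eq
    by (simp add: matrix_vector_mult_diff_distrib matrix_vector_mul_assoc matrix_mul_assoc)
  hence "(M *v y) \<bullet> (M *v y) = 0"
    by (metis dot_lmul_matrix inner_zero_left vector_transpose_matrix transpose_transpose)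
  thus "(M ** Y) *v x = (M ** Z) *v x"
    by (simp add: y_def matrix_vector_mult_diff_distrib flip: matrix_vector_mul_assoc)
qed

lemma gram_inverse:
  fixes M :: "real^'m^'n"
  assumes T: "generalized_inverse (transpose M ** M) T"
  shows "M ** T ** transpose M ** M = M"
    and "transpose (M ** T ** transpose M) = M ** T ** transpose M"
proof -
  have *: "M ** U ** transpose M ** M = M"
    if "generalized_inverse (transpose M ** M) U" for U
    using gram_cancel[of M "U ** (transpose M ** M)" "mat 1"] that
    by (simp add: generalized_inverse_def matrix_mul_assoc)
  show 1: "M ** T ** transpose M ** M = M" by (rule *[OF T])
  have "generalized_inverse (transpose M ** M) (transpose T)"
    using arg_cong[OF T[unfolded generalized_inverse_def], of transpose]
    by (simp add: generalized_inverse_def matrix_transpose_mul matrix_mul_assoc)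
  from *[OF this] have 2: "M ** transpose T ** transpose M ** M = M" .
  have 3: "transpose M ** M ** T ** transpose M = transpose M"
    using arg_cong[OF 2, of transpose] by (simp add: matrix_transpose_mul matrix_mul_assoc)
  have "M ** T ** transpose M = M ** transpose T ** (transpose M ** M ** T ** transpose M)"
    using 2 by (simp add: matrix_mul_assoc)
  thus "transpose (M ** T ** transpose M) = M ** T ** transpose M"
    using 3 by (simp add: matrix_transpose_mul matrix_mul_assoc)
qed

lemma moore_penrose_ex1:
  fixes M :: "real^'m^'n"
  shows "\<exists>!X. is_moore_penrose M X"
proof (rule ex_ex1I)
  obtain T where T: "generalized_inverse (transpose M ** M) T"
    using generalized_inverse_exists by blast
  obtain S where "generalized_inverse (M ** transpose M) S"
    using generalized_inverse_exists by blast
  hence S: "generalized_inverse (transpose (transpose M) ** transpose M) S" by simp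
  note t = gram_inverse[OF T] and s = gram_inverse[OF S, simplified]
  have s3: "M ** transpose M ** S ** M = M"
  proof -
    have "transpose (transpose M ** S ** M ** transpose M) = M ** (transpose M ** S ** M)"
      using s(2) by (simp only: matrix_transpose_mul[of _ "transpose M"] transpose_transpose)
    thus ?thesis using s(1) by (simp add: matrix_mul_assoc)
  qed
  define X where "X = transpose M ** S ** M ** T ** transpose M"
  have MX: "M ** X = M ** T ** transpose M"
    by (simp add: X_def matrix_mul_assoc s3)
  have XM: "X ** M = transpose M ** S ** M"
  proof -
    have "X ** M = transpose M ** S ** (M ** T ** transpose M ** M)"
      by (simp add: X_def matrix_mul_assoc)
    thus ?thesis using t(1) by simp
  qed
  have "X ** M ** X = X"
  proof -
    have "X ** M ** X = transpose M ** S ** (M ** transpose M ** S ** M) ** T ** transpose M"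
      unfolding XM by (simp add: X_def matrix_mul_assoc)
    thus ?thesis using s3 by (simp add: X_def)
  qed
  with MX XM t s have "is_moore_penrose M X"
    by (simp add: is_moore_penrose_def)
  thus "\<exists>X. is_moore_penrose M X" ..
next
  fix X Y assume "is_moore_penrose M X" "is_moore_penrose M Y"
  hence x: "M ** X ** M = M" "X ** M ** X = X"
      "transpose (M ** X) = M ** X" "transpose (X ** M) = X ** M"
    and y: "M ** Y ** M = M" "Y ** M ** Y = Y"
      "transpose (M ** Y) = M ** Y" "transpose (Y ** M) = Y ** M"
    by (auto simp: is_moore_penrose_def)
  have "M ** X = M ** Y ** (M ** X)" using y(1) by (simp add: matrix_mul_assoc)
  also have "\<dots> = transpose (M ** X ** (M ** Y))" using x y by (simp add: matrix_transpose_mul)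
  also have "\<dots> = M ** Y" using x y by (simp add: matrix_mul_assoc)
  finally have a: "M ** X = M ** Y" .
  have "X ** M = X ** (M ** Y ** M)" using y(1) by simp
  also have "\<dots> = X ** M ** (Y ** M)" by (simp add: matrix_mul_assoc)
  also have "\<dots> = transpose (Y ** M ** (X ** M))" using x y by (simp add: matrix_transpose_mul)
  also have "\<dots> = transpose (Y ** (M ** X ** M))" by (simp add: matrix_mul_assoc)
  also have "\<dots> = Y ** M" using x y by simp
  finally have "X ** M = Y ** M" .
  hence "X ** M ** X = Y ** (M ** X)" by (simp add: matrix_mul_assoc)
  also have "\<dots> = Y ** M ** Y" unfolding a by (rule matrix_mul_assoc)
  finally show "X = Y" unfolding x(2) y(2) .
qed

lemma moore_penrose: "is_moore_penrose M (moore_penrose M)"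
  unfolding moore_penrose_def by (rule theI'[OF moore_penrose_ex1])

lemma laplacian_mult_vector:
  "(laplacian E *v z) $ u = (\<Sum>v | {u, v} \<in> E. z $ u - z $ v)"
proof -
  have "(laplacian E *v z) $ u = (\<Sum>v\<in>UNIV. (if u = v then real (degree E u) * z $ v else 0)
      - (if {u, v} \<in> E then z $ v else 0))"
    by (auto simp: matrix_vector_mult_def laplacian_def degree_matrix_def adjacency_matrix_def
        algebra_simps intro!: sum.cong)
  also have "\<dots> = real (degree E u) * z $ u - (\<Sum>v | {u, v} \<in> E. z $ v)"
    by (simp add: sum_subtractf sum.If_cases)
  finally show ?thesis by (simp add: sum_subtractf degree_def)
qed

lemma transpose_laplacian: "transpose (laplacian E) = laplacian E"
  by (auto simp: transpose_def laplacian_def degree_matrix_def adjacency_matrix_def vec_eq_iff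
      insert_commute)

lemma laplacian_kernel:
  assumes "connected_graph E" "laplacian E *v z = 0"
  shows "z $ u = z $ v"
proof -
  have "0 = (\<Sum>u\<in>UNIV. z $ u * (laplacian E *v z) $ u)" using assms(2) by simp
  also have "\<dots> = (\<Sum>u\<in>UNIV. \<Sum>v\<in>UNIV. if {u, v} \<in> E then z $ u * (z $ u - z $ v) else 0)"
    by (simp add: laplacian_mult_vector sum_distrib_left sum.If_cases)
  finally have 1: "0 = (\<Sum>u\<in>UNIV. \<Sum>v\<in>UNIV. if {u, v} \<in> E then z $ u * (z $ u - z $ v) else 0)" .
  hence 2: "0 = (\<Sum>u\<in>UNIV. \<Sum>v\<in>UNIV. if {u, v} \<in> E then z $ v * (z $ v - z $ u) else 0)"
    by (subst sum.swap) (simp add: insert_commute)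
  have "0 = (\<Sum>u\<in>UNIV. \<Sum>v\<in>UNIV. (if {u, v} \<in> E then z $ u * (z $ u - z $ v) else 0)
        + (if {u, v} \<in> E then z $ v * (z $ v - z $ u) else 0))"
    using 1 2 by (simp add: sum.distrib)
  also have "\<dots> = (\<Sum>u\<in>UNIV. \<Sum>v\<in>UNIV. if {u, v} \<in> E then (z $ u - z $ v)\<^sup>2 else 0)"
    by (intro sum.cong refl) (simp add: power2_eq_square algebra_simps)
  finally have "(\<Sum>u\<in>UNIV. \<Sum>v\<in>UNIV. if {u, v} \<in> E then (z $ u - z $ v)\<^sup>2 else 0) = 0" by simp
  hence "\<forall>u\<in>UNIV. (\<Sum>v\<in>UNIV. if {u, v} \<in> E then (z $ u - z $ v)\<^sup>2 else 0) = 0"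
    by (subst (asm) sum_nonneg_eq_0_iff) (auto intro!: sum_nonneg)
  hence "\<forall>u. \<forall>v\<in>UNIV. (if {u, v} \<in> E then (z $ u - z $ v)\<^sup>2 else 0) = 0"
    by (subst (asm) sum_nonneg_eq_0_iff) auto
  hence *: "z $ a = z $ b" if "{a, b} \<in> E" for a b
    using that by (metis UNIV_I eq_iff_diff_eq_0 zero_eq_power2)
  have "(\<lambda>a b. {a, b} \<in> E)\<^sup>*\<^sup>* u v" using assms(1) by (simp add: connected_graph_def)
  thus ?thesis by induction (use * in auto)
qed

lemma incidence_vector_in_range:
  fixes E :: "'n::finite set set"
  assumes "connected_graph E" "a \<noteq> b"
  obtains w where "incidence_vector a b = laplacian E *v w"
proof -
  define L where "L = laplacian E"
  define P where "P = moore_penrose L"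
  define x :: "real^'n" where "x = incidence_vector a b"
  have P: "L ** P ** L = L" "transpose (L ** P) = L ** P"
    using moore_penrose[of L] by (auto simp: P_def is_moore_penrose_def)
  have sym: "transpose L = L" by (simp add: L_def transpose_laplacian)
  have LLP: "L ** (L ** P) = L"
    using arg_cong[OF P(1), of transpose] P(2) sym by (simp add: matrix_transpose_mul)
  define z where "z = x - (L ** P) *v x"
  have "L *v z = 0"
    by (simp add: z_def matrix_vector_mult_diff_distrib matrix_vector_mul_assoc LLP)
  hence z: "z = (z $ a) *\<^sub>R 1"
    using laplacian_kernel[OF assms(1)] by (auto simp: vec_eq_iff L_def)
  have L1: "L *v 1 = 0" by (simp add: L_def vec_eq_iff laplacian_mult_vector)
  have "1 \<bullet> ((L ** P) *v x) = (L *v 1) \<bullet> (P *v x)"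
    by (metis dot_lmul_matrix matrix_vector_mul_assoc sym vector_transpose_matrix)
  moreover have "1 \<bullet> x = 0"
  proof -
    have "1 \<bullet> x = (\<Sum>v\<in>UNIV. (if v = a then 1 else 0) - (if v = b then 1 else 0))"
      using assms(2) by (auto simp: inner_vec_def x_def incidence_vector_def intro!: sum.cong)
    thus ?thesis by (simp add: sum_subtractf)
  qed
  ultimately have "1 \<bullet> z = 0" by (simp add: z_def inner_diff_right L1)
  hence "z $ a * (1 \<bullet> (1 :: real^'n)) = 0" using z by (metis inner_scaleR_right)
  hence "z $ a = 0" by (simp add: inner_vec_def)
  with z have "z = 0" by (metis scaleR_zero_left)
  hence "x = L *v (P *v x)" by (simp add: z_def matrix_vector_mul_assoc)
  thus ?thesis using that by (simp add: x_def L_def)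
qed

lemma inner_incidence_vector:
  fixes X :: "real^'n^'n"
  assumes "a \<noteq> b"
  shows "incidence_vector a b \<bullet> (X *v incidence_vector a b)
    = X $ a $ a + X $ b $ b - X $ a $ b - X $ b $ a"
proof -
  have x: "incidence_vector a b = axis a 1 - axis b (1::real)"
    using assms by (auto simp: incidence_vector_def axis_def vec_eq_iff)
  show ?thesis
    by (simp add: x matrix_vector_mult_diff_distrib inner_diff_left inner_diff_right
        inner_axis' matrix_vector_mult_basis column_def)
qed

lemma resistance_distance_eq:
  assumes "connected_graph E" "generalized_inverse (laplacian E) H"
  shows "resistance_distance E a b = H $ a $ a + H $ b $ b - H $ a $ b - H $ b $ a"
proof (cases "a = b")
  case False
  define L where "L = laplacian E"
  obtain w where w: "incidence_vector a b = L *v w"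
    using incidence_vector_in_range[OF assms(1) False] by (auto simp: L_def)
  have *: "X $ a $ a + X $ b $ b - X $ a $ b - X $ b $ a = w \<bullet> (L *v w)"
    if "generalized_inverse L X" for X
  proof -
    have "(L *v w) \<bullet> (X *v (L *v w)) = w \<bullet> (L *v (X *v (L *v w)))"
      by (metis L_def dot_lmul_matrix transpose_laplacian vector_transpose_matrix)
    also have "\<dots> = w \<bullet> (L *v w)"
      using that by (simp add: generalized_inverse_def matrix_vector_mul_assoc matrix_mul_assoc)
    finally show ?thesis using inner_incidence_vector[OF False, of X] by (simp add: w)
  qed
  have "generalized_inverse L (SOME H. generalized_inverse L H)"
    by (rule someI_ex[OF generalized_inverse_exists])
  from *[OF this] *[of H] assms(2) show ?thesis
    by (simp add: resistance_distance_def Let_def L_def)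
qed (simp add: resistance_distance_def Let_def)

end

theory Submission
  imports Defs
begin

text \<open>
  Deleting \<open>f\<close> is the rank-one update \<open>L\<^sub>f = L - x\<^sub>f x\<^sub>f\<^sup>T\<close>, so solutions of \<open>L\<^sub>f w = x\<close> are
  explicit combinations of solutions of \<open>L z = x\<close>; every condition other than (iii) then says that
  \<open>x\<^sub>e\<^sup>T L\<^sup>- x\<^sub>f = 0\<close>.  Condition (iii) reduces to (ii) by Kirchhoff's formula
  \<open>\<tau>(E - f) = \<tau>(E) (1 - r\<^sub>E(k, l))\<close>, applied to \<open>G\<close> and to \<open>G - e\<close>.

  Kirchhoff's formula needs no determinants.  For a vertex \<open>a\<close> let \<open>v(a)\<close> be the number of spanning
  trees \<open>T\<close> containing \<open>f = {k, l}\<close> such that \<open>a\<close> is on the side of \<open>k\<close> in \<open>T - f\<close>.  Exchanging \<open>f\<close>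
  for an edge \<open>{a, b}\<close> turns \<open>v(a) - v(b)\<close> into a signed count of the trees whose path from \<open>k\<close> to
  \<open>l\<close> runs through \<open>{a, b}\<close>.  In each tree this path is a unit flow, so \<open>L v = \<tau>(E) x\<^sub>f\<close>, whence
  \<open>\<tau>(E) r\<^sub>E(k, l) = v(k) - v(l)\<close> is the number of spanning trees containing \<open>f\<close>.
\<close>

section \<open>Reachability and minimal connected graphs\<close>

definition reach :: "'n set set \<Rightarrow> 'n \<Rightarrow> 'n \<Rightarrow> bool" where
  "reach E = (\<lambda>a b. {a, b} \<in> E)\<^sup>*\<^sup>*"

lemma connected_graph_iff: "connected_graph E \<longleftrightarrow> (\<forall>u v. reach E u v)"
  by (simp add: connected_graph_def reach_def)

lemma reach_refl [simp, intro]: "reach E a a"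
  by (simp add: reach_def)

lemma reach_trans: "reach E a b \<Longrightarrow> reach E b c \<Longrightarrow> reach E a c"
  by (auto simp: reach_def)

lemma reach_edge: "{a, b} \<in> E \<Longrightarrow> reach E a b"
  by (auto simp: reach_def)

lemma reach_induct [consumes 1, case_names base step]:
  assumes "reach E a b" "P a"
    and "\<And>y z. reach E a y \<Longrightarrow> {y, z} \<in> E \<Longrightarrow> P y \<Longrightarrow> P z"
  shows "P b"
  using assms(1)[unfolded reach_def]
  by (rule rtranclp_induct) (auto intro: assms simp: reach_def)

lemma reach_sym: "reach E a b \<Longrightarrow> reach E b a"
  by (induction rule: reach_induct) (simp, metis insert_commute reach_edge reach_trans)

text \<open>Each edge of a walk is replaced by a walk in \<open>F\<close>; this is how connectivity
  survives the deletion and the exchange of edges.\<close>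

lemma reach_lift:
  assumes "reach E u v" and "\<And>a b. {a, b} \<in> E \<Longrightarrow> reach F a b"
  shows "reach F u v"
  using assms(1) by (induction rule: reach_induct) (auto intro: assms(2) reach_trans)

lemma reach_mono: "reach E u v \<Longrightarrow> E \<subseteq> F \<Longrightarrow> reach F u v"
  by (erule reach_lift) (auto intro: reach_edge)

lemma connected_graph_mono: "connected_graph E \<Longrightarrow> E \<subseteq> F \<Longrightarrow> connected_graph F"
  by (auto simp: connected_graph_iff intro: reach_mono)

lemma connected_graph_delete:
  assumes "connected_graph E" "reach (E - {{a, b}}) a b"
  shows "connected_graph (E - {{a, b}})"
proof -
  have "reach (E - {{a, b}}) c d" if "{c, d} \<in> E" for c d
  proof (cases "{c, d} = {a, b}")
    case True
    thus ?thesis using assms(2) reach_sym by (auto simp: doubleton_eq_iff)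
  qed (use that in \<open>auto intro: reach_edge\<close>)
  thus ?thesis using assms(1) unfolding connected_graph_iff by (blast intro: reach_lift)
qed

text \<open>Steps along \<open>F\<close> stay in one \<open>F\<close>-component, and a step along
  \<open>{a, b}\<close> ends at \<open>a\<close> or \<open>b\<close>.\<close>

lemma reach_insert_edge:
  assumes "reach (insert {a, b} F) x y" "reach F a x \<or> reach F b x"
  shows "reach F a y \<or> reach F b y"
  using assms
proof (induction rule: reach_induct)
  case (step y z)
  show ?case
  proof (cases "{y, z} \<in> F")
    case True
    thus ?thesis using step by (meson reach_edge reach_trans)
  next
    case False
    hence "{y, z} = {a, b}" using step by simp
    thus ?thesis by (auto simp: doubleton_eq_iff)
  qed
qed

lemma reach_delete_edge:
  assumes "connected_graph (insert {a, b} F)"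
  shows "reach F x a \<or> reach F x b"
proof -
  have "reach (insert {a, b} F) a x" using assms by (simp add: connected_graph_iff)
  from reach_insert_edge[OF this] show ?thesis using reach_sym by fastforce
qed

text \<open>Loop erasure: when the walk returns to a vertex already listed, the list is cut off
  there.\<close>

lemma reach_distinct_path:
  assumes "reach E u v"
  shows "\<exists>vs. vs \<noteq> [] \<and> vs ! 0 = u \<and> last vs = v \<and> distinct vs \<and>
    (\<forall>m. Suc m < length vs \<longrightarrow> {vs ! m, vs ! Suc m} \<in> E)"
  using assms
proof (induction rule: reach_induct)
  case base
  show ?case by (rule exI[of _ "[u]"]) auto
next
  case (step v w)
  then obtain vs where vs: "vs \<noteq> []" "vs ! 0 = u" "last vs = v" "distinct vs"
    "\<And>m. Suc m < length vs \<Longrightarrow> {vs ! m, vs ! Suc m} \<in> E" by blast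
  show ?case
  proof (cases "w \<in> set vs")
    case True
    then obtain p where p: "p < length vs" "vs ! p = w" by (auto simp: in_set_conv_nth)
    have "last (take (Suc p) vs) = w" using p by (simp add: take_Suc_conv_app_nth)
    thus ?thesis using vs p by (intro exI[of _ "take (Suc p) vs"]) auto
  next
    case False
    have "{(vs @ [w]) ! m, (vs @ [w]) ! Suc m} \<in> E" if "Suc m < length (vs @ [w])" for m
    proof (cases "Suc m < length vs")
      case False
      hence "m = length vs - 1" using that by simp
      moreover have "{vs ! (length vs - 1), w} \<in> E"
        using vs step by (simp add: last_conv_nth)
      ultimately show ?thesis using vs(1) by (simp add: nth_append)
    qed (use vs in \<open>simp add: nth_append\<close>)
    thus ?thesis using vs False by (intro exI[of _ "vs @ [w]"]) (auto simp: nth_append)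
  qed
qed

text \<open>Replaces acyclicity by a condition on reachability alone;
  \<open>spanning_trees_eq\<close> identifies the two inside a simple graph.\<close>

definition min_connected :: "'n set set \<Rightarrow> bool" where
  "min_connected T \<longleftrightarrow> connected_graph T \<and> (\<forall>e\<in>T. \<not> connected_graph (T - {e}))"

text \<open>The closing edge of the cycle can go, since the rest of the cycle still joins its
  ends.\<close>

lemma connected_delete_if_cycle:
  assumes "connected_graph T" "graph_cycle T vs"
  shows "\<exists>e\<in>T. connected_graph (T - {e})"
proof -
  define n where "n = length vs"
  have n: "3 \<le> n" "distinct vs" and
    edge: "\<And>m. m < n \<Longrightarrow> {vs ! m, vs ! (Suc m mod n)} \<in> T"
    using assms(2) by (auto simp: graph_cycle_def n_def)
  let ?e = "{vs ! 0, vs ! (n - 1)}"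
  have "reach (T - {?e}) (vs ! 0) (vs ! m)" if "m < n" for m
    using that
  proof (induction m)
    case (Suc m)
    have "{vs ! m, vs ! Suc m} \<in> T" using edge[of m] Suc by simp
    \<comment> \<open>By distinctness, equality would force \<open>m = 0\<close> and
      \<open>Suc m = n - 1\<close>, a cycle of length 2; the other matching has
      \<open>Suc m = 0\<close>.\<close>
    moreover have "{vs ! m, vs ! Suc m} \<noteq> ?e"
    proof
      assume "{vs ! m, vs ! Suc m} = ?e"
      hence "m = 0 \<and> Suc m = n - 1 \<or> m = n - 1 \<and> Suc m = 0"
        unfolding doubleton_eq_iff using n Suc.prems nth_eq_iff_index_eq[OF n(2)]
        by (metis Suc_lessD diff_less less_le_trans n_def zero_less_numeral zero_less_one)
      thus False using n(1) by auto
    qed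
    ultimately show ?case using Suc by (meson DiffI Suc_lessD reach_edge reach_trans singletonD)
  qed simp
  hence "connected_graph (T - {?e})"
    using n by (intro connected_graph_delete assms) auto
  moreover have "?e \<in> T" using edge[of "n - 1"] n by (simp add: insert_commute)
  ultimately show ?thesis by blast
qed

text \<open>A distinct path joining the ends of \<open>e\<close> in \<open>T - {e}\<close> closes up
  through \<open>e\<close>.\<close>

lemma cycle_if_connected_delete:
  assumes "simple_graph T" "e \<in> T" "connected_graph (T - {e})"
  shows "\<exists>vs. graph_cycle T vs"
proof -
  obtain a b where ab: "e = {a, b}" "a \<noteq> b"
    using assms by (metis card_2_iff simple_graph_def)
  have "reach (T - {e}) a b" using assms(3) by (simp add: connected_graph_iff)
  then obtain vs where vs: "vs \<noteq> []" "vs ! 0 = a" "last vs = b" "distinct vs"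
    "\<And>m. Suc m < length vs \<Longrightarrow> {vs ! m, vs ! Suc m} \<in> T - {e}"
    using reach_distinct_path by metis
  have l: "vs ! (length vs - 1) = b" using vs by (simp add: last_conv_nth)
  \<comment> \<open>A single vertex would give \<open>a = b\<close>; with two vertices the only edge
    of the path would be \<open>e\<close>.\<close>
  have "length vs \<noteq> 0" using vs by simp
  moreover have "length vs \<noteq> 1" using vs l ab by auto
  moreover have "length vs \<noteq> 2" using vs(2) vs(5)[of 0] l ab by auto
  ultimately have 3: "3 \<le> length vs" by linarith
  have "{vs ! m, vs ! (Suc m mod length vs)} \<in> T" if "m < length vs" for m
  proof (cases "Suc m < length vs")
    case False
    hence "m = length vs - 1" using that by simp
    thus ?thesis using vs(1,2) l ab assms(2) by (simp add: insert_commute)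
  qed (use vs(5) in simp)
  thus ?thesis using 3 vs(4) by (auto simp: graph_cycle_def)
qed

lemma spanning_trees_eq:
  assumes "simple_graph E"
  shows "spanning_trees E = {T. T \<subseteq> E \<and> min_connected T}"
proof -
  have "simple_graph T" if "T \<subseteq> E" for T using that assms by (auto simp: simple_graph_def)
  thus ?thesis
    unfolding spanning_trees_def min_connected_def
    using connected_delete_if_cycle cycle_if_connected_delete by blast
qed

lemma min_connected_subset:
  fixes E :: "'n::finite set set"
  assumes "connected_graph E"
  shows "\<exists>T\<subseteq>E. min_connected T"
proof -
  have "finite E" by simp
  thus ?thesis using assms
  proof (induction E rule: finite_psubset_induct)
    case (psubset E)
    show ?case
    proof (cases "min_connected E")
      case False
      then obtain e where "e \<in> E" "connected_graph (E - {e})"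
        using psubset by (auto simp: min_connected_def)
      thus ?thesis using psubset.IH[of "E - {e}"] by blast
    qed auto
  qed
qed

section \<open>Counting spanning trees by the side of a deleted edge\<close>

lemma min_connected_not_reach:
  assumes "min_connected T" "{a, b} \<in> T"
  shows "\<not> reach (T - {{a, b}}) a b"
  using assms connected_graph_delete[of T a b] by (auto simp: min_connected_def)

text \<open>At least one alternative holds because \<open>T\<close> is connected, at most one
  because \<open>{a, b}\<close> cannot be spared.\<close>

lemma min_connected_sides:
  assumes "min_connected T" "{a, b} \<in> T"
  shows "reach (T - {{a, b}}) x a \<longleftrightarrow> \<not> reach (T - {{a, b}}) x b"
proof -
  have "connected_graph (insert {a, b} (T - {{a, b}}))"
    using assms by (simp add: insert_absorb min_connected_def)
  from reach_delete_edge[OF this] min_connected_not_reach[OF assms] show ?thesis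
    by (meson reach_sym reach_trans)
qed

text \<open>\<open>{c, d}\<close> crosses between the two sides of \<open>{a, b}\<close> and so
  reconnects them. If another edge \<open>g\<close> could then be deleted, exchanging
  \<open>{c, d}\<close> back for \<open>{a, b}\<close> would leave \<open>T - {g}\<close>
  connected.\<close>

lemma min_connected_exchange:
  assumes T: "min_connected T" "{a, b} \<in> T"
    and c: "reach (T - {{a, b}}) c a" and d: "reach (T - {{a, b}}) d b"
  shows "{c, d} \<notin> T - {{a, b}}" and "min_connected (insert {c, d} (T - {{a, b}}))"
proof -
  define F where "F = T - {{a, b}}"
  have T_F: "T = insert {a, b} F" "{a, b} \<notin> F" using T by (auto simp: F_def)
  have nab: "\<not> reach F a b" using min_connected_not_reach[OF T] by (simp add: F_def)
  have c: "reach F c a" and d: "reach F d b" using c d by (auto simp: F_def)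
  have ncd: "\<not> reach F c d" using c d nab by (meson reach_sym reach_trans)
  hence cd: "{c, d} \<notin> F" using reach_edge by fast
  thus "{c, d} \<notin> T - {{a, b}}" by (simp add: F_def)
  \<comment> \<open>The ends of an added edge may be moved within their \<open>H\<close>-components;
    this serves the exchange in both directions.\<close>
  have transfer: "connected_graph (insert {x, y} H)"
    if "connected_graph (insert {p, q} H)" "reach H x p" "reach H y q" for x y p q :: 'a and H
  proof -
    have up: "reach (insert {x, y} H) g h" if "reach H g h" for g h
      using that by (rule reach_mono) auto
    have "reach (insert {x, y} H) x y" by (rule reach_edge) simp
    hence pq: "reach (insert {x, y} H) p q"
      by (rule reach_trans[OF reach_sym[OF up[OF that(2)]] reach_trans[OF _ up[OF that(3)]]])
    have edge: "reach (insert {x, y} H) g h" if "{g, h} \<in> insert {p, q} H" for g h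
    proof (cases "{g, h} = {p, q}")
      case True
      thus ?thesis using pq reach_sym[OF pq] by (auto simp: doubleton_eq_iff)
    qed (use that in \<open>simp add: reach_edge\<close>)
    show ?thesis
      unfolding connected_graph_iff
    proof (intro allI)
      fix g h
      have "reach (insert {p, q} H) g h" using that(1) by (simp add: connected_graph_iff)
      thus "reach (insert {x, y} H) g h" by (rule reach_lift) (rule edge)
    qed
  qed
  have "connected_graph (insert {a, b} F)" using T T_F by (simp add: min_connected_def)
  hence "connected_graph (insert {c, d} F)" using c d by (rule transfer)
  moreover have False if g: "g \<in> insert {c, d} F" "connected_graph (insert {c, d} F - {g})" for g
  proof (cases "g = {c, d}")
    case True
    hence "connected_graph F" using g cd by simp
    thus False using nab by (simp add: connected_graph_iff)
  next
    case False
    define H where "H = F - {g}"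
    have gF: "g \<in> F" and H: "connected_graph (insert {c, d} H)"
      using g False by (auto simp: H_def insert_Diff_if)
    have HF: "reach H x y \<Longrightarrow> reach F x y" for x y
      by (erule reach_mono) (auto simp: H_def)
    \<comment> \<open>Within \<open>H\<close>, \<open>a\<close> is joined to \<open>c\<close> or to
      \<open>d\<close>; the latter would join \<open>c\<close> to \<open>d\<close> in
      \<open>F\<close>. The same argument places \<open>b\<close> with \<open>d\<close>.\<close>
    have "reach H a c" using reach_delete_edge[OF H, of a] HF c ncd
      by (meson reach_sym reach_trans)
    moreover have "reach H b d" using reach_delete_edge[OF H, of b] HF d ncd
      by (meson reach_sym reach_trans)
    ultimately have "connected_graph (insert {a, b} H)" by (rule transfer[OF H])
    moreover have "insert {a, b} H = T - {g}" using T_F gF by (auto simp: H_def)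
    ultimately show False using T(1) gF T_F by (auto simp: min_connected_def)
  qed
  ultimately show "min_connected (insert {c, d} (T - {{a, b}}))"
    unfolding F_def[symmetric] min_connected_def by blast
qed

text \<open>For \<open>{a, b} = {k, l}\<close> this is the family counted by v(x) in the overview;
  the order of \<open>a\<close> and \<open>b\<close> selects the side.\<close>

definition edge_side_trees :: "'n set set \<Rightarrow> 'n \<Rightarrow> 'n \<Rightarrow> 'n \<Rightarrow> 'n set set set" where
  "edge_side_trees E x a b =
     {T. T \<subseteq> E \<and> min_connected T \<and> {a, b} \<in> T \<and> reach (T - {{a, b}}) x a}"

text \<open>The trees whose path from \<open>x\<close> to \<open>y\<close> traverses the edge from
  \<open>a\<close> to \<open>b\<close>.\<close>

definition edge_split_trees :: "'n set set \<Rightarrow> 'n \<Rightarrow> 'n \<Rightarrow> 'n \<Rightarrow> 'n \<Rightarrow> 'n set set set" where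
  "edge_split_trees E x y a b = edge_side_trees E x a b \<inter> edge_side_trees E y b a"

lemma edge_split_trees_swap: "edge_split_trees E x y a b = edge_split_trees E y x b a"
  by (auto simp: edge_split_trees_def)

text \<open>Deleting \<open>{a, b}\<close> leaves a forest with \<open>a, c\<close> on one side and
  \<open>b, d\<close> on the other; adding \<open>{c, d}\<close> instead gives a tree of the other
  family, and the same exchange leads back.\<close>

lemma card_edge_split_trees:
  fixes E :: "'n::finite set set"
  assumes "{a, b} \<in> E" "{c, d} \<in> E"
  shows "card (edge_split_trees E c d a b) = card (edge_split_trees E a b c d)"
proof (rule bij_betw_same_card[of "\<lambda>T. insert {c, d} (T - {{a, b}})"])
  have *: "insert {c, d} (T - {{a, b}}) \<in> edge_split_trees E a b c d \<and>
      insert {a, b} (insert {c, d} (T - {{a, b}}) - {{c, d}}) = T"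
    if "T \<in> edge_split_trees E c d a b" "{c, d} \<in> E" for T a b c d
  proof -
    have T: "T \<subseteq> E" "min_connected T" "{a, b} \<in> T" "reach (T - {{a, b}}) c a"
      "reach (T - {{a, b}}) d b"
      using that by (auto simp: edge_split_trees_def edge_side_trees_def insert_commute)
    note ex = min_connected_exchange[OF T(2-)]
    have "insert {c, d} (T - {{a, b}}) - {{c, d}} = T - {{a, b}}" using ex(1) by blast
    thus ?thesis using T ex that
      by (auto simp: edge_split_trees_def edge_side_trees_def insert_commute[of d c]
          intro: reach_sym)
  qed
  show "bij_betw (\<lambda>T. insert {c, d} (T - {{a, b}}))
      (edge_split_trees E c d a b) (edge_split_trees E a b c d)"
    by (rule bij_betw_byWitness[where f' = "\<lambda>T. insert {a, b} (T - {{c, d}})"])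
      (use *[of _ c d a b] *[of _ a b c d] assms in auto)
qed

text \<open>Trees with both \<open>x\<close> and \<open>y\<close> on the side of \<open>a\<close>
  occur in both counts and cancel.\<close>

lemma card_edge_side_trees_diff:
  fixes E :: "'n::finite set set"
  shows "real (card (edge_side_trees E x a b)) - card (edge_side_trees E y a b) =
    real (card (edge_split_trees E x y a b)) - card (edge_split_trees E y x a b)"
proof -
  have *: "card (edge_side_trees E x a b) =
      card (edge_split_trees E x y a b) + card (edge_side_trees E x a b \<inter> edge_side_trees E y a b)"
    for x y
  proof -
    have "edge_side_trees E x a b = edge_split_trees E x y a b \<union>
        (edge_side_trees E x a b \<inter> edge_side_trees E y a b)"
      using min_connected_sides[of _ a b y]
      by (auto simp: edge_split_trees_def edge_side_trees_def insert_commute)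
    moreover have "edge_split_trees E x y a b \<inter>
        (edge_side_trees E x a b \<inter> edge_side_trees E y a b) = {}"
      using min_connected_sides[of _ a b y]
      by (auto simp: edge_split_trees_def edge_side_trees_def insert_commute)
    ultimately show ?thesis by (metis card_Un_disjoint finite)
  qed
  show ?thesis using *[of x y] *[of y x] by (simp add: Int_commute)
qed

text \<open>Each side is a difference of two split counts, which the exchange bijection matches term
  by term. On the right this is the net number of trees whose path from \<open>c\<close> to
  \<open>d\<close> passes from \<open>a\<close> to \<open>b\<close>.\<close>

lemma edge_side_trees_reciprocity:
  fixes E :: "'n::finite set set"
  assumes "{a, b} \<in> E" "{c, d} \<in> E"
  shows "real (card (edge_side_trees E a c d)) - card (edge_side_trees E b c d) =
    real (card (edge_side_trees E c a b)) - card (edge_side_trees E d a b)"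
  using card_edge_split_trees[OF assms] card_edge_split_trees[of b a E c d] assms
    edge_split_trees_swap[of E c d b a]
  by (simp add: card_edge_side_trees_diff insert_commute)

lemma card_separating_edges:
  fixes T :: "'n::finite set set"
  assumes "min_connected T"
  shows "card {b. {u, b} \<in> T \<and> \<not> reach (T - {{u, b}}) x u} = (if x = u then 0 else 1)"
proof (cases "x = u")
  case False
  \<comment> \<open>the only such \<open>b\<close> is the neighbour of \<open>u\<close> from which \<open>x\<close> is reached without returning to \<open>u\<close>\<close>
  define S where "S = {e \<in> T. u \<notin> e}"
  \<comment> \<open>Along a walk from \<open>u\<close>, \<open>b\<close> is the vertex entered after
    the latest visit to \<open>u\<close>.\<close>
  have "x = u \<or> (\<exists>b. {u, b} \<in> T \<and> reach S b x)"
  proof -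
    have "reach T u x" using assms by (simp add: min_connected_def connected_graph_iff)
    thus ?thesis
    proof (induction rule: reach_induct)
      case (step y z)
      show ?case
      proof (cases "z = u \<or> y = u")
        case True
        thus ?thesis using step by auto
      next
        case False
        hence "{y, z} \<in> S" using step by (auto simp: S_def)
        thus ?thesis using step False by (meson reach_edge reach_trans)
      qed
    qed simp
  qed
  then obtain b where b: "{u, b} \<in> T" "reach S b x" using False by blast
  have S: "reach (T - {{u, c}}) b x" for c
    by (rule reach_mono[OF b(2)]) (auto simp: S_def)
  have "{c. {u, c} \<in> T \<and> \<not> reach (T - {{u, c}}) x u} = {b}"
  proof (intro equalityI subsetI)
    fix c assume "c \<in> {c. {u, c} \<in> T \<and> \<not> reach (T - {{u, c}}) x u}"
    hence c: "\<not> reach (T - {{u, c}}) x u" by simp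
    show "c \<in> {b}"
    proof (rule ccontr)
      assume "c \<notin> {b}"
      hence "{u, b} \<in> T - {{u, c}}" using b by (auto simp: doubleton_eq_iff)
      with S[of c] c show False by (meson reach_edge reach_sym reach_trans)
    qed
  next
    fix c assume "c \<in> {b}"
    thus "c \<in> {c. {u, c} \<in> T \<and> \<not> reach (T - {{u, c}}) x u}"
      using b(1) S[of b] min_connected_not_reach[OF assms b(1)]
      by (auto intro: reach_sym reach_trans)
  qed
  thus ?thesis using False by simp
qed simp

text \<open>Double counting of trees with an edge at \<open>u\<close> that leaves \<open>x\<close>
  on the side of \<open>u\<close>: every tree edge at \<open>u\<close> except, for
  \<open>x \<noteq> u\<close>, the one towards \<open>x\<close>. The degree sum does not involve
  \<open>x\<close> and cancels when two values of \<open>x\<close> are compared.\<close>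

lemma sum_edge_side_trees:
  fixes E :: "'n::finite set set"
  assumes "simple_graph E"
  shows "(\<Sum>b | {u, b} \<in> E. real (card (edge_side_trees E x u b))) =
    (\<Sum>T\<in>spanning_trees E. real (degree T u)) - (if x = u then 0 else real (\<tau> E))"
proof -
  define P where "P T b \<longleftrightarrow> {u, b} \<in> T \<and> reach (T - {{u, b}}) x u" for T b
  have "(\<Sum>b | {u, b} \<in> E. real (card (edge_side_trees E x u b))) =
      (\<Sum>b\<in>UNIV. \<Sum>T\<in>spanning_trees E. if P T b then 1 else 0)"
  proof (rule sum.mono_neutral_cong_left)
    show "\<forall>b\<in>UNIV - {b. {u, b} \<in> E}. (\<Sum>T\<in>spanning_trees E. if P T b then 1 else 0) = (0::real)"
      by (auto simp: P_def spanning_trees_def intro!: sum.neutral split: if_splits)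
    fix b
    have "edge_side_trees E x u b = {T \<in> spanning_trees E. P T b}"
      by (auto simp: spanning_trees_eq[OF assms] edge_side_trees_def P_def)
    thus "real (card (edge_side_trees E x u b)) = (\<Sum>T\<in>spanning_trees E. if P T b then 1 else 0)"
      by (simp add: sum.If_cases Int_def)
  qed auto
  also have "\<dots> = (\<Sum>T\<in>spanning_trees E. real (card {b. P T b}))"
    by (subst sum.swap) (simp add: sum.If_cases)
  also have "\<dots> = (\<Sum>T\<in>spanning_trees E. real (degree T u) - (if x = u then 0 else 1))"
  proof (rule sum.cong[OF refl])
    fix T assume "T \<in> spanning_trees E"
    hence T: "min_connected T" by (simp add: spanning_trees_eq[OF assms])
    have "{b. {u, b} \<in> T} = {b. P T b} \<union> {b. {u, b} \<in> T \<and> \<not> reach (T - {{u, b}}) x u}"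
      by (auto simp: P_def)
    hence "degree T u =
        card {b. P T b} + card {b. {u, b} \<in> T \<and> \<not> reach (T - {{u, b}}) x u}"
      unfolding degree_def by (metis (no_types, lifting) Int_emptyI P_def card_Un_disjoint finite
          mem_Collect_eq)
    thus "real (card {b. P T b}) = real (degree T u) - (if x = u then 0 else 1)"
      using card_separating_edges[OF T, of u x] by simp
  qed
  finally show ?thesis by (simp add: sum_subtractf num_spanning_trees_def)
qed

section \<open>Resistance distance and spanning trees\<close>

lemma generalized_inverse_moore_penrose: "generalized_inverse M (moore_penrose M)"
  using moore_penrose[of M] by (simp add: is_moore_penrose_def generalized_inverse_def)

lemma inner_laplacian_commute: "(laplacian E *v x) \<bullet> y = x \<bullet> (laplacian E *v y)"
  by (metis dot_lmul_matrix transpose_laplacian vector_transpose_matrix)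

text \<open>By symmetry of the Laplacian L the left side is the inner product of p with L X L q = L
  q, so it does not depend on the choice of \<open>X\<close>.\<close>

lemma inner_generalized_inverse_laplacian:
  assumes "generalized_inverse (laplacian E) X" "laplacian E *v p = x" "laplacian E *v q = y"
  shows "x \<bullet> (X *v y) = x \<bullet> q"
proof -
  have "laplacian E *v (X *v (laplacian E *v q)) = laplacian E *v q"
    using assms(1) by (simp add: generalized_inverse_def matrix_vector_mul_assoc matrix_mul_assoc)
  thus ?thesis using assms(2,3) by (metis inner_laplacian_commute)
qed

lemma incidence_vector_inner:
  assumes "a \<noteq> b"
  shows "incidence_vector a b \<bullet> z = z $ a - z $ b"
proof -
  have "incidence_vector a b = axis a 1 - axis b (1::real)"
    using assms by (auto simp: incidence_vector_def axis_def vec_eq_iff)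
  thus ?thesis by (simp add: inner_diff_left inner_axis')
qed

lemma incidence_vector_uminus:
  assumes "a \<noteq> b"
  shows "incidence_vector b a = - incidence_vector a b"
  using assms by (auto simp: incidence_vector_def vec_eq_iff)

text \<open>Bridges are covered, both sides then being 0; this matters because deleting both edges
  of the theorem may disconnect \<open>G\<close>.\<close>

lemma num_spanning_trees_delete:
  fixes E :: "'n::finite set set"
  assumes E: "simple_graph E" "connected_graph E" "{k, l} \<in> E"
  shows "real (\<tau> (E - {{k, l}})) = real (\<tau> E) * (1 - resistance_distance E k l)"
proof -
  have kl: "k \<noteq> l" using E by (force simp: simple_graph_def)
  define v :: "real^'n" where "v = (\<chi> a. real (card (edge_side_trees E a k l)))"
  define x :: "real^'n" where "x = incidence_vector k l"
  have Lv: "laplacian E *v v = real (\<tau> E) *\<^sub>R x"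
  proof (rule vec_eq_iff[THEN iffD2], rule allI)
    fix u
    \<comment> \<open>Reciprocity turns differences across the edges at \<open>u\<close> into side
      counts of those edges. The degree sums cancel, leaving \<open>\<tau> E\<close> at
      \<open>k\<close>, its negative at \<open>l\<close>, and 0 elsewhere.\<close>
    have "(laplacian E *v v) $ u = (\<Sum>b | {u, b} \<in> E.
        real (card (edge_side_trees E k u b)) - card (edge_side_trees E l u b))"
      unfolding laplacian_mult_vector v_def
      using edge_side_trees_reciprocity[OF _ E(3)] by (intro sum.cong) auto
    also have "\<dots> = (real (\<tau> E) *\<^sub>R x) $ u"
      using kl by (auto simp: sum_subtractf sum_edge_side_trees[OF E(1)] x_def incidence_vector_def)
    finally show "(laplacian E *v v) $ u = (real (\<tau> E) *\<^sub>R x) $ u" .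
  qed
  define H where "H = moore_penrose (laplacian E)"
  have H: "generalized_inverse (laplacian E) H"
    unfolding H_def by (rule generalized_inverse_moore_penrose)
  obtain w where w: "laplacian E *v w = x"
    using incidence_vector_in_range[OF E(2) kl] by (metis x_def)
  have "real (\<tau> E) * resistance_distance E k l = real (\<tau> E) * (x \<bullet> (H *v x))"
    by (simp add: resistance_distance_eq[OF E(2) H] x_def inner_incidence_vector[OF kl])
  also have "\<dots> = real (\<tau> E) * (x \<bullet> w)"
    by (simp add: inner_generalized_inverse_laplacian[OF H w w])
  \<comment> \<open>Both sides are the inner product of \<open>v\<close> with
    \<open>laplacian E *v w\<close>, by symmetry.\<close>
  also have "\<dots> = x \<bullet> v"
    by (metis Lv inner_commute inner_laplacian_commute inner_scaleR_right w)
  also have "\<dots> = v $ k - v $ l"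
    by (simp add: x_def incidence_vector_inner[OF kl])
  \<comment> \<open>\<open>k\<close> is always on its own side and \<open>l\<close> never is, so
    \<open>v $ l = 0\<close>.\<close>
  also have "\<dots> = real (card {T \<in> spanning_trees E. {k, l} \<in> T})"
  proof -
    have "edge_side_trees E l k l = {}"
      using min_connected_not_reach reach_sym by (fastforce simp: edge_side_trees_def)
    moreover have "edge_side_trees E k k l = {T \<in> spanning_trees E. {k, l} \<in> T}"
      by (auto simp: edge_side_trees_def spanning_trees_eq[OF E(1)])
    ultimately show ?thesis by (simp add: v_def)
  qed
  finally have "real (\<tau> E) * resistance_distance E k l =
      real (card {T \<in> spanning_trees E. {k, l} \<in> T})" .
  moreover have "\<tau> E = card {T \<in> spanning_trees E. {k, l} \<in> T} + \<tau> (E - {{k, l}})"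
  proof -
    have "spanning_trees E = {T \<in> spanning_trees E. {k, l} \<in> T} \<union> spanning_trees (E - {{k, l}})"
      by (auto simp: spanning_trees_def)
    moreover have "{T \<in> spanning_trees E. {k, l} \<in> T} \<inter> spanning_trees (E - {{k, l}}) = {}"
      by (auto simp: spanning_trees_def)
    ultimately show ?thesis
      unfolding num_spanning_trees_def by (metis card_Un_disjoint finite)
  qed
  ultimately show ?thesis by (simp add: algebra_simps)
qed

lemma num_spanning_trees_pos:
  assumes "simple_graph E" "connected_graph E"
  shows "\<tau> E > 0"
  using min_connected_subset[OF assms(2)] spanning_trees_eq[OF assms(1)]
  by (auto simp: num_spanning_trees_def card_gt_0_iff)

text \<open>By Kirchhoff's formula for \<open>G\<close> and \<open>G - {e}\<close>, both products
  equal \<open>\<tau> G * \<tau> (G - {e})\<close> times one minus the respective resistance; the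
  common factor is positive.\<close>

lemma resistance_criterion:
  assumes "simple_graph G" "e \<in> G" "{k, l} \<in> G" "e \<noteq> {k, l}" "connected_graph (G - {e})"
  shows "resistance_distance G k l = resistance_distance (G - {e}) k l \<longleftrightarrow>
    \<tau> (G - {e}) * \<tau> (G - {{k, l}}) = \<tau> G * \<tau> (G - {e, {k, l}})"
proof -
  have G: "connected_graph G" "simple_graph (G - {e})"
    using assms connected_graph_mono[of "G - {e}" G] by (auto simp: simple_graph_def)
  have "real (\<tau> (G - {{k, l}})) = real (\<tau> G) * (1 - resistance_distance G k l)"
    using assms G by (intro num_spanning_trees_delete) auto
  moreover have "G - {e, {k, l}} = G - {e} - {{k, l}}" by auto
  hence "real (\<tau> (G - {e, {k, l}})) =
      real (\<tau> (G - {e})) * (1 - resistance_distance (G - {e}) k l)"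
    using assms G num_spanning_trees_delete[of "G - {e}" k l] by auto
  moreover have "\<tau> G > 0" "\<tau> (G - {e}) > 0"
    by (intro num_spanning_trees_pos; fact)+
  moreover have "\<tau> (G - {e}) * \<tau> (G - {{k, l}}) = \<tau> G * \<tau> (G - {e, {k, l}}) \<longleftrightarrow>
      real (\<tau> (G - {e})) * real (\<tau> (G - {{k, l}})) = real (\<tau> G) * real (\<tau> (G - {e, {k, l}}))"
    unfolding of_nat_mult[symmetric] of_nat_eq_iff ..
  ultimately show ?thesis by auto
qed

section \<open>Deleting an edge as a rank-one update\<close>

text \<open>Leaves the orientation open: a change of sign affects neither the orthogonality
  conditions nor the quadratic forms below.\<close>

definition edge_vector :: "'n \<Rightarrow> 'n \<Rightarrow> real^'n::finite \<Rightarrow> bool" where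
  "edge_vector a b x \<longleftrightarrow> a \<noteq> b \<and> (x = incidence_vector a b \<or> x = incidence_vector b a)"

lemma edge_vector_cases:
  assumes "edge_vector a b x"
  shows "x = incidence_vector a b \<or> x = - incidence_vector a b"
  using assms incidence_vector_uminus by (auto simp: edge_vector_def)

lemma edge_vector_orthogonal: "edge_vector a b x \<Longrightarrow> x \<bullet> z = 0 \<longleftrightarrow> z $ a = z $ b"
  by (auto simp: edge_vector_def incidence_vector_inner)

lemma edge_vector_resistance:
  assumes "edge_vector a b x" "connected_graph E" "generalized_inverse (laplacian E) X"
  shows "resistance_distance E a b = x \<bullet> (X *v x)"
  using assms(1) inner_incidence_vector[of a b X] inner_incidence_vector[of b a X]
  by (auto simp: edge_vector_def resistance_distance_eq[OF assms(2,3)])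

lemma edge_vector_in_range:
  assumes "edge_vector a b x" "connected_graph E"
  shows "\<exists>w. laplacian E *v w = x"
  using assms unfolding edge_vector_def by (metis incidence_vector_in_range)

text \<open>The two Laplacians differ by the outer product of \<open>x\<close> with itself, which is
  the same for both orientations.\<close>

lemma laplacian_delete_edge:
  assumes "{k, l} \<in> E" "edge_vector k l x"
  shows "laplacian E *v z = laplacian (E - {{k, l}}) *v z + (x \<bullet> z) *\<^sub>R x"
proof (rule vec_eq_iff[THEN iffD2], rule allI)
  fix u
  have kl: "k \<noteq> l" using assms(2) by (simp add: edge_vector_def)
  have "{v. {u, v} \<in> E} = {v. {u, v} \<in> E - {{k, l}}} \<union> {v. {u, v} = {k, l}}"
    using assms(1) by auto
  hence "(laplacian E *v z) $ u = (laplacian (E - {{k, l}}) *v z) $ u +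
      (\<Sum>v | {u, v} = {k, l}. z $ u - z $ v)"
    unfolding laplacian_mult_vector by (subst sum.union_disjoint[symmetric]) auto
  also have "{v. {u, v} = {k, l}} = (if u = k then {l} else if u = l then {k} else {})"
    using kl by (auto simp: doubleton_eq_iff)
  also have "(\<Sum>v\<in>\<dots>. z $ u - z $ v) = ((x \<bullet> z) *\<^sub>R x) $ u"
    using edge_vector_cases[OF assms(2)] kl
    by (auto simp: incidence_vector_inner) (auto simp: incidence_vector_def)
  finally show "(laplacian E *v z) $ u =
      (laplacian (E - {{k, l}}) *v z + (x \<bullet> z) *\<^sub>R x) $ u" by simp
qed

text \<open>Let wx, wy solve the deleted system for x, y, and zx, zy the full one. Applying the full
  Laplacian to wx and wy expresses them through zx and zy: y.wx is a nonzero multiple of y.zx, and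
  y.wy - y.zy is the product of y.wx and y.zx.\<close>

lemma deleted_edge_potentials:
  fixes E :: "'n::finite set set"
  assumes "{k, l} \<in> E" "edge_vector k l x" "edge_vector a b y"
    and conn: "connected_graph (E - {{k, l}})"
    and X: "generalized_inverse (laplacian E) X"
    and Y: "generalized_inverse (laplacian (E - {{k, l}})) Y"
  shows "y \<bullet> (Y *v x) = 0 \<longleftrightarrow> y \<bullet> (X *v x) = 0"
    and "y \<bullet> (X *v y) = y \<bullet> (Y *v y) \<longleftrightarrow> y \<bullet> (X *v x) = 0"
proof -
  define D where "D = E - {{k, l}}"
  have D: "connected_graph D" using conn by (simp add: D_def)
  have E: "connected_graph E" using conn by (rule connected_graph_mono) auto
  obtain zx zy where z: "laplacian E *v zx = x" "laplacian E *v zy = y"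
    using edge_vector_in_range assms(2,3) E by metis
  obtain wx wy where w: "laplacian D *v wx = x" "laplacian D *v wy = y"
    using edge_vector_in_range assms(2,3) D by metis
  have upd: "laplacian E *v v = laplacian D *v v + (x \<bullet> v) *\<^sub>R x" for v
    unfolding D_def by (rule laplacian_delete_edge) fact+
  have Yx: "y \<bullet> (Y *v x) = y \<bullet> wx" "y \<bullet> (Y *v y) = y \<bullet> wy"
    by (rule inner_generalized_inverse_laplacian[OF Y[folded D_def] w(2)]; fact)+
  have Xx: "y \<bullet> (X *v x) = y \<bullet> zx" "y \<bullet> (X *v y) = y \<bullet> zy"
    by (rule inner_generalized_inverse_laplacian[OF X z(2)]; fact)+
  have inner_y: "y \<bullet> v = zy \<bullet> (laplacian E *v v)" for v
    using z(2) inner_laplacian_commute by metis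
  have "laplacian E *v wx = (1 + x \<bullet> wx) *\<^sub>R x"
    using upd[of wx] w by (simp add: algebra_simps)
  hence 1: "y \<bullet> wx = (1 + x \<bullet> wx) * (y \<bullet> zx)"
    by (simp add: inner_y z)
  \<comment> \<open>If the factor vanished, \<open>wx\<close> would lie in the kernel and be
    constant, so \<open>x \<bullet> wx\<close> would be 0 rather than -1.\<close>
  have nz: "1 + x \<bullet> wx \<noteq> 0"
  proof
    assume "1 + x \<bullet> wx = 0"
    hence "laplacian E *v wx = 0"
      using \<open>laplacian E *v wx = (1 + x \<bullet> wx) *\<^sub>R x\<close> by simp
    hence "wx $ k = wx $ l" by (rule laplacian_kernel[OF E])
    hence "x \<bullet> wx = 0" using edge_vector_orthogonal[OF assms(2)] by blast
    with \<open>1 + x \<bullet> wx = 0\<close> show False by simp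
  qed
  show yx: "y \<bullet> (Y *v x) = 0 \<longleftrightarrow> y \<bullet> (X *v x) = 0"
    using 1 nz by (simp add: Yx Xx)
  have "x \<bullet> wy = y \<bullet> wx" using w by (metis inner_commute inner_laplacian_commute)
  hence "laplacian E *v wy = y + (y \<bullet> wx) *\<^sub>R x" using upd[of wy] w by simp
  hence "y \<bullet> wy = y \<bullet> zy + (y \<bullet> wx) * (y \<bullet> zx)"
    by (simp add: inner_y z inner_add_right)
  thus "y \<bullet> (X *v y) = y \<bullet> (Y *v y) \<longleftrightarrow> y \<bullet> (X *v x) = 0"
    using yx by (auto simp: Yx Xx)
qed

text \<open>Links the conditions on the Moore-Penrose inverse to those on all generalized
  inverses.\<close>

lemma inner_generalized_inverse_unique:
  assumes "connected_graph E" "edge_vector a b y" "edge_vector c d x"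
    and "generalized_inverse (laplacian E) X" "generalized_inverse (laplacian E) Y"
  shows "y \<bullet> (X *v x) = y \<bullet> (Y *v x)"
  using edge_vector_in_range assms inner_generalized_inverse_laplacian by metis

text \<open>\<open>X\<close> itself may be asymmetric, but both sides reduce to a symmetric form in
  the solutions \<open>p\<close> and \<open>q\<close>.\<close>

lemma potentials_symmetric:
  assumes "connected_graph E" "edge_vector a b y" "edge_vector c d x"
    and "generalized_inverse (laplacian E) X"
  shows "y \<bullet> (X *v x) = x \<bullet> (X *v y)"
proof -
  obtain p q where "laplacian E *v p = x" "laplacian E *v q = y"
    using edge_vector_in_range assms by metis
  thus ?thesis
    using assms(4) by (metis inner_commute inner_generalized_inverse_laplacian
        inner_laplacian_commute)
qed

section \<open>Equivalence of the eleven conditions\<close>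

theorem theorem7p1:
  fixes G :: "'n::finite set set"
    and e f :: "'n set"
    and i j k l :: 'n
    and L L_e L_f :: "real^'n^'n"
    and x_e x_f :: "real^'n"
  assumes "CARD('n) \<ge> 4"
    and "simple_graph G"
    and "e = {i, j}" and "f = {k, l}"
    and "e \<in> G" and "f \<in> G"
    and "e \<inter> f = {}"
    and "connected_graph (G - {e})" and "connected_graph (G - {f})"
    and "L = laplacian G"
    and "L_e = laplacian (G - {e})"
    and "L_f = laplacian (G - {f})"
    and "x_e = incidence_vector i j \<or> x_e = incidence_vector j i"
    and "x_f = incidence_vector k l \<or> x_f = incidence_vector l k"
  shows "all_equivalent
    [ resistance_distance G i j = resistance_distance (G - {f}) i j,
      resistance_distance G k l = resistance_distance (G - {e}) k l,
      \<tau> (G - {e}) * \<tau> (G - {f}) = \<tau> G * \<tau> (G - {e, f}),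
      (moore_penrose L *v x_f) $ i = (moore_penrose L *v x_f) $ j,
      \<forall>X. generalized_inverse L X \<longrightarrow> (X *v x_f) $ i = (X *v x_f) $ j,
      (moore_penrose L_f *v x_f) $ i = (moore_penrose L_f *v x_f) $ j,
      \<forall>X. generalized_inverse L_f X \<longrightarrow> (X *v x_f) $ i = (X *v x_f) $ j,
      (moore_penrose L *v x_e) $ k = (moore_penrose L *v x_e) $ l,
      \<forall>X. generalized_inverse L X \<longrightarrow> (X *v x_e) $ k = (X *v x_e) $ l,
      (moore_penrose L_e *v x_e) $ k = (moore_penrose L_e *v x_e) $ l,
      \<forall>X. generalized_inverse L_e X \<longrightarrow> (X *v x_e) $ k = (X *v x_e) $ l ]"
proof -
  have "i \<noteq> j" "k \<noteq> l" using assms(2-6) by (auto simp: simple_graph_def)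
  hence ev: "edge_vector i j x_e" "edge_vector k l x_f"
    using assms(13,14) by (auto simp: edge_vector_def)
  have conn: "connected_graph G" using assms(8) by (rule connected_graph_mono) auto
  let ?P = "moore_penrose L" and ?Pe = "moore_penrose L_e" and ?Pf = "moore_penrose L_f"
  have gi: "generalized_inverse L ?P" "generalized_inverse L_e ?Pe" "generalized_inverse L_f ?Pf"
    by (rule generalized_inverse_moore_penrose)+
  \<comment> \<open>The update lemma is applied twice, with the roles of the deleted edge and the
    measured edge exchanged.\<close>
  note del_f = deleted_edge_potentials[of k l G x_f i j x_e, folded assms(4), folded assms(10,12),
      OF assms(6) ev(2,1) assms(9) gi(1,3)]
    and del_e = deleted_edge_potentials[of i j G x_e k l x_f, folded assms(3), folded assms(10,11),
      OF assms(5) ev assms(8) gi(1,2)]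
  have sym: "x_f \<bullet> (?P *v x_e) = x_e \<bullet> (?P *v x_f)"
    by (rule potentials_symmetric[OF conn ev(2,1) gi(1)[unfolded assms(10)], folded assms(10)])
  have pots: "(X *v x_f) $ i = (X *v x_f) $ j \<longleftrightarrow> x_e \<bullet> (X *v x_f) = 0"
    "(X *v x_e) $ k = (X *v x_e) $ l \<longleftrightarrow> x_f \<bullet> (X *v x_e) = 0" for X
    using edge_vector_orthogonal ev by metis+
  have all: "(\<forall>X. generalized_inverse M X \<longrightarrow> y \<bullet> (X *v x) = 0) \<longleftrightarrow>
      y \<bullet> (moore_penrose M *v x) = 0"
    if "M = laplacian E" "connected_graph E" "edge_vector a b y" "edge_vector c d x"
    for M E a b c d and x y :: "real^'n"
    using inner_generalized_inverse_unique[OF that(2-4)] generalized_inverse_moore_penrose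
    unfolding that(1) by metis
  have f: "x_e \<bullet> (?Pf *v x_f) = 0 \<longleftrightarrow> x_e \<bullet> (?P *v x_f) = 0"
    "resistance_distance G i j = resistance_distance (G - {f}) i j \<longleftrightarrow> x_e \<bullet> (?P *v x_f) = 0"
    using del_f edge_vector_resistance[OF ev(1) conn, folded assms(10), OF gi(1)]
      edge_vector_resistance[OF ev(1) assms(9), folded assms(12), OF gi(3)] by simp_all
  have e: "x_f \<bullet> (?Pe *v x_e) = 0 \<longleftrightarrow> x_e \<bullet> (?P *v x_f) = 0"
    "resistance_distance G k l = resistance_distance (G - {e}) k l \<longleftrightarrow> x_e \<bullet> (?P *v x_f) = 0"
    using del_e sym edge_vector_resistance[OF ev(2) conn, folded assms(10), OF gi(1)]
      edge_vector_resistance[OF ev(2) assms(8), folded assms(11), OF gi(2)] by simp_all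
  have "e \<noteq> f" using assms(3,7) by auto
  \<comment> \<open>The tree-count identity is equivalent to the resistance condition for
    \<open>k\<close> and \<open>l\<close>, already reduced in \<open>e(2)\<close>.\<close>
  hence tau: "\<tau> (G - {e}) * \<tau> (G - {f}) = \<tau> G * \<tau> (G - {e, f}) \<longleftrightarrow>
      x_e \<bullet> (?P *v x_f) = 0"
    using resistance_criterion[of G e k l, folded assms(4)] assms(2,5,6,8) e(2) by simp
  show ?thesis
    \<comment> \<open>all eleven statements become \<open>x\<^sub>e\<^sup>T L\<^sup>+ x\<^sub>f = 0\<close>\<close>
    unfolding all_equivalent_def pots
      all[OF assms(10) conn ev] all[OF assms(12) assms(9) ev]
      all[OF assms(10) conn ev(2,1)] all[OF assms(11) assms(8) ev(2,1)]
    by (simp add: f e tau sym)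
qed

end
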